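(* Let $Z$ be a complex-affine manifold that admits finitely many locally nilpotent derivations generating an infinitely transitive action on $Z$. Then $Z\times\mathbb{C}$ also admits finitely many locally nilpotent derivations generating an infinitely transitive action on $Z\times\mathbb{C}$.
   Context: A complex-affine manifold is a smooth affine algebraic variety over $\mathbb{C}$. Locally nilpotent derivations (LNDs) are derivations of the coordinate ring, identified with algebraic vector fields; their flows are algebraic one-parameter groups of automorphisms. Finitely many LNDs "generate an infinitely transitive action" if the group of automorphisms generated by their flows acts $m$-transitively for every $m\in\mathbb{N}$, i.e. any $m$-tuple of pairwise distinct points can be mapped to any other such $m$-tuple by an element of the group.
   Formalization: Z is assumed not to be a single point: a point is vacuously infinitely transitive with no derivations, but on the complex line the locally nilpotent derivations only generate translations, which are not 2-transitive. *)

theory Defs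
  imports
    "HOL-Analysis.Analysis"
    "HOL-Algebra.Bij"
    "HOL-Algebra.Generated_Groups"
begin

inductive_set poly_fun :: "(complex ^ 'n::finite \<Rightarrow> complex) set" where
  const: "(\<lambda>_. c) \<in> poly_fun"
| coord: "(\<lambda>x. x $ i) \<in> poly_fun"
| add: "F \<in> poly_fun \<Longrightarrow> G \<in> poly_fun \<Longrightarrow> (\<lambda>x. F x + G x) \<in> poly_fun"
| mult: "F \<in> poly_fun \<Longrightarrow> G \<in> poly_fun \<Longrightarrow> (\<lambda>x. F x * G x) \<in> poly_fun"

definition zariski_closed :: "(complex ^ 'n::finite) set \<Rightarrow> bool" where
  "zariski_closed X \<longleftrightarrow> (\<exists>P \<subseteq> poly_fun. X = {x. \<forall>F\<in>P. F x = 0})"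

definition zariski_irreducible :: "(complex ^ 'n::finite) set \<Rightarrow> bool" where
  "zariski_irreducible X \<longleftrightarrow> X \<noteq> {} \<and>
     (\<forall>A B. zariski_closed A \<and> zariski_closed B \<and> X \<subseteq> A \<union> B \<longrightarrow> X \<subseteq> A \<or> X \<subseteq> B)"

definition vanishing_ideal :: "(complex ^ 'n::finite) set \<Rightarrow> (complex ^ 'n \<Rightarrow> complex) set" where
  "vanishing_ideal X = {F \<in> poly_fun. \<forall>x\<in>X. F x = 0}"

definition tangent_space ::
    "(complex ^ 'n::finite) set \<Rightarrow> complex ^ 'n \<Rightarrow> (complex ^ 'n) set" where
  "tangent_space Z p =
     {v. \<forall>F\<in>vanishing_ideal Z. ((\<lambda>t. F (p + t *s v)) has_field_derivative 0) (at 0)}"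

text \<open>
  The Krull dimension of the local ring of \<open>Z\<close> at \<open>p\<close>, via chains of irreducible closed
  subsets through \<open>p\<close>. The supremum is taken over a nonempty set bounded by the dimension
  of the ambient space when \<open>Z\<close> is closed and contains \<open>p\<close>.
\<close>
definition local_dim :: "(complex ^ 'n::finite) set \<Rightarrow> complex ^ 'n \<Rightarrow> nat" where
  "local_dim Z p = Sup {d. \<exists>C :: nat \<Rightarrow> (complex ^ 'n) set.
     (\<forall>i\<le>d. zariski_closed (C i) \<and> zariski_irreducible (C i) \<and> p \<in> C i \<and> C i \<subseteq> Z) \<and>
     (\<forall>i<d. C i \<subset> C (Suc i))}"

text \<open>
  Irreducibility is not imposed; \<open>vec.dim\<close> is the dimension over the complex numbers.
\<close>
definition complex_affine_manifold :: "(complex ^ 'n::finite) set \<Rightarrow> bool" where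
  "complex_affine_manifold Z \<longleftrightarrow>
     zariski_closed Z \<and> (\<forall>p\<in>Z. vec.dim (tangent_space Z p) = local_dim Z p)"

text \<open>
  Regular functions on \<open>Z\<close> are made total by the value 0 outside \<open>Z\<close>, so that equality
  of regular functions on \<open>Z\<close> is equality of HOL functions.
\<close>
definition coord_ring :: "(complex ^ 'n::finite) set \<Rightarrow> (complex ^ 'n \<Rightarrow> complex) set" where
  "coord_ring Z = (\<lambda>F x. if x \<in> Z then F x else 0) ` poly_fun"

definition derivation ::
    "(complex ^ 'n::finite) set \<Rightarrow> ((complex ^ 'n \<Rightarrow> complex) \<Rightarrow> (complex ^ 'n \<Rightarrow> complex)) \<Rightarrow> bool" where
  "derivation Z D \<longleftrightarrow>
     (\<forall>f\<in>coord_ring Z. D f \<in> coord_ring Z) \<and>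
     (\<forall>f\<in>coord_ring Z. \<forall>g\<in>coord_ring Z. D (\<lambda>x. f x + g x) = (\<lambda>x. D f x + D g x)) \<and>
     (\<forall>c. \<forall>f\<in>coord_ring Z. D (\<lambda>x. c * f x) = (\<lambda>x. c * D f x)) \<and>
     (\<forall>f\<in>coord_ring Z. \<forall>g\<in>coord_ring Z. D (\<lambda>x. f x * g x) = (\<lambda>x. D f x * g x + f x * D g x))"

definition locally_nilpotent_derivation ::
    "(complex ^ 'n::finite) set \<Rightarrow> ((complex ^ 'n \<Rightarrow> complex) \<Rightarrow> (complex ^ 'n \<Rightarrow> complex)) \<Rightarrow> bool" where
  "locally_nilpotent_derivation Z D \<longleftrightarrow>
     derivation Z D \<and> (\<forall>f\<in>coord_ring Z. \<exists>k. (D ^^ k) f = (\<lambda>_. 0))"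

text \<open>
  The flow, in complex time, of the vector field given by \<open>D\<close>: the one-parameter group of
  transformations of \<open>Z\<close> with infinitesimal generator \<open>D\<close>. For a locally nilpotent \<open>D\<close> it
  exists and is unique on \<open>Z\<close>, being the action with comorphisms \<open>exp (t D)\<close>.
\<close>
definition is_flow ::
    "(complex ^ 'n::finite) set \<Rightarrow> ((complex ^ 'n \<Rightarrow> complex) \<Rightarrow> (complex ^ 'n \<Rightarrow> complex)) \<Rightarrow>
      (complex \<Rightarrow> complex ^ 'n \<Rightarrow> complex ^ 'n) \<Rightarrow> bool" where
  "is_flow Z D \<phi> \<longleftrightarrow> (\<forall>p\<in>Z.
     (\<forall>t. \<phi> t p \<in> Z) \<and> \<phi> 0 p = p \<and> (\<forall>s t. \<phi> (s + t) p = \<phi> s (\<phi> t p)) \<and>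
     (\<forall>f\<in>coord_ring Z. ((\<lambda>t. f (\<phi> t p)) has_field_derivative D f p) (at 0)))"

definition flow_group ::
    "(complex ^ 'n::finite) set \<Rightarrow> ((complex ^ 'n \<Rightarrow> complex) \<Rightarrow> (complex ^ 'n \<Rightarrow> complex)) set \<Rightarrow>
      (complex ^ 'n \<Rightarrow> complex ^ 'n) set" where
  "flow_group Z S =
     generate (BijGroup Z) {restrict (\<phi> t) Z | \<phi> t. \<exists>D\<in>S. is_flow Z D \<phi>}"

definition m_transitive :: "'a set \<Rightarrow> ('a \<Rightarrow> 'a) set \<Rightarrow> nat \<Rightarrow> bool" where
  "m_transitive Z G m \<longleftrightarrow>
     (\<forall>xs ys. length xs = m \<and> length ys = m \<and> distinct xs \<and> distinct ys \<and>
        set xs \<subseteq> Z \<and> set ys \<subseteq> Z \<longrightarrow> (\<exists>g\<in>G. map g xs = ys))"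

text \<open>
  Pitfall: a one-point \<open>Z\<close> satisfies this with \<open>S = {}\<close>, since \<open>m\<close>-transitivity is then vacuous
  for \<open>m \<ge> 2\<close>, whereas the affine line does not: its locally nilpotent derivations are the
  constant vector fields, whose flows are translations.
\<close>
definition admits_infinitely_transitive_LNDs :: "(complex ^ 'n::finite) set \<Rightarrow> bool" where
  "admits_infinitely_transitive_LNDs Z \<longleftrightarrow>
     (\<exists>S. finite S \<and> (\<forall>D\<in>S. locally_nilpotent_derivation Z D) \<and>
          (\<forall>m. m_transitive Z (flow_group Z S) m))"

text \<open>
  The product of \<open>Z\<close> with the affine line; the index \<open>None\<close> carries the extra coordinate.
\<close>
definition times_line :: "(complex ^ 'n::finite) set \<Rightarrow> (complex ^ 'n option) set" where
  "times_line Z =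
     (\<lambda>(z, w). \<chi> i. case i of None \<Rightarrow> w | Some j \<Rightarrow> z $ j) ` (Z \<times> UNIV)"

end

theory Submission imports Defs begin

text \<open>
  Lift each derivation \<open>D\<close> on \<open>Z\<close> to \<open>D\<close> and \<open>w D\<close> on the product, where \<open>w\<close> is the coordinate
  of the line, and add the shear \<open>z\<^sub>l \<partial>/\<partial>w\<close> for a coordinate \<open>z\<^sub>l\<close> not constant on \<open>Z\<close>. The flows of
  the \<open>w D\<close> make the base points of a tuple pairwise distinct; the lifts of the \<open>D\<close> then move
  these base points to arbitrary distinct positions with fixed fibre coordinates; and shears
  conjugated by such motions adjust the fibre coordinates one at a time.
\<close>

section \<open>Coordinate rings and derivations\<close>

text \<open>The obstacle is a pair of points in the same fibre. A flow lifted from \<open>Z\<close>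
  with weight 1 acts on the base alone, and a shear does not touch the base, so neither can ever
  separate their base points. The weight \<open>w\<close> does: distinct points of one fibre have
  distinct \<open>w\<close> and therefore run along the same orbit at different speeds. Local
  nilpotency survives the modification because \<open>w\<close> lies in the kernel of every lift,
  and likewise \<open>z\<close> lies in the kernel of the shear. The total is twice the given number
  of derivations plus one, hence finite. Each lifted flow is an explicit formula in a flow on
  \<open>Z\<close>, and the flows on \<open>Z\<close> come from the transitivity assumed there. A
  non-constant coordinate is what gives a shear different effects over two base points
  \<open>a\<close> and \<open>b\<close>; the difference of the two effects can be confined to one
  point of a tuple.\<close>

lemma coord_ring_const: "(\<lambda>x. if x \<in> Z then c else 0) \<in> coord_ring Z"
  unfolding coord_ring_def by (rule image_eqI[OF _ poly_fun.const[of c]]) auto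

lemma coord_ring_coord: "(\<lambda>x. if x \<in> Z then x $ i else 0) \<in> coord_ring Z"
  unfolding coord_ring_def by (rule image_eqI[OF _ poly_fun.coord[of i]]) auto

lemma coord_ring_add:
  assumes "f \<in> coord_ring Z" "g \<in> coord_ring Z"
  shows "(\<lambda>x. f x + g x) \<in> coord_ring Z"
proof -
  obtain F G where "F \<in> poly_fun" "G \<in> poly_fun"
    "f = (\<lambda>x. if x \<in> Z then F x else 0)" "g = (\<lambda>x. if x \<in> Z then G x else 0)"
    using assms unfolding coord_ring_def by blast
  then show ?thesis
    unfolding coord_ring_def by (intro image_eqI[OF _ poly_fun.add[of F G]]) auto
qed

lemma coord_ring_mult:
  assumes "f \<in> coord_ring Z" "g \<in> coord_ring Z"
  shows "(\<lambda>x. f x * g x) \<in> coord_ring Z"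
proof -
  obtain F G where "F \<in> poly_fun" "G \<in> poly_fun"
    "f = (\<lambda>x. if x \<in> Z then F x else 0)" "g = (\<lambda>x. if x \<in> Z then G x else 0)"
    using assms unfolding coord_ring_def by blast
  then show ?thesis
    unfolding coord_ring_def by (intro image_eqI[OF _ poly_fun.mult[of F G]]) auto
qed

lemma coord_ring_outside: "f \<in> coord_ring Z \<Longrightarrow> x \<notin> Z \<Longrightarrow> f x = 0"
  by (auto simp: coord_ring_def)

text \<open>The polynomial needs no cut-off, since \<open>f\<close> already vanishes outside
  \<open>Z\<close>. This supplies the weights of the lifted derivations, which are polynomials on
  the whole ambient space.\<close>

lemma coord_ring_poly_mult:
  assumes "F \<in> poly_fun" "f \<in> coord_ring Z"
  shows "(\<lambda>x. F x * f x) \<in> coord_ring Z"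
proof -
  have "(\<lambda>x. (if x \<in> Z then F x else 0) * f x) \<in> coord_ring Z"
    using assms by (intro coord_ring_mult) (auto simp: coord_ring_def)
  also have "(\<lambda>x. (if x \<in> Z then F x else 0) * f x) = (\<lambda>x. F x * f x)"
    using coord_ring_outside[OF assms(2)] by auto
  finally show ?thesis .
qed

lemma coord_ring_zero: "(\<lambda>_. 0) \<in> coord_ring Z"
  using coord_ring_const[of Z 0] by simp

text \<open>Induction over a polynomial representative, with every intermediate function cut off to
  0 outside \<open>Z\<close>, so that the cases stay inside the coordinate ring.\<close>

lemma coord_ring_induct [consumes 1, case_names const coord add mult]:
  assumes "f \<in> coord_ring Z"
    and "\<And>c. P (\<lambda>x. if x \<in> Z then c else 0)"
    and "\<And>i. P (\<lambda>x. if x \<in> Z then x $ i else 0)"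
    and add: "\<And>f g. f \<in> coord_ring Z \<Longrightarrow> g \<in> coord_ring Z \<Longrightarrow> P f \<Longrightarrow> P g \<Longrightarrow> P (\<lambda>x. f x + g x)"
    and mult: "\<And>f g. f \<in> coord_ring Z \<Longrightarrow> g \<in> coord_ring Z \<Longrightarrow> P f \<Longrightarrow> P g \<Longrightarrow> P (\<lambda>x. f x * g x)"
  shows "P f"
proof -
  obtain F where F: "F \<in> poly_fun" "f = (\<lambda>x. if x \<in> Z then F x else 0)"
    using assms(1) by (auto simp: coord_ring_def)
  have "P (\<lambda>x. if x \<in> Z then F x else 0)"
    using F(1)
  proof induction
    case (add F G)
    have "P (\<lambda>x. (if x \<in> Z then F x else 0) + (if x \<in> Z then G x else 0))"
      using add by (intro assms(4)) (auto simp: coord_ring_def)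
    also have "(\<lambda>x. (if x \<in> Z then F x else 0) + (if x \<in> Z then G x else 0)) =
        (\<lambda>x. if x \<in> Z then F x + G x else 0)"
      by auto
    finally show ?case .
  next
    case (mult F G)
    have "P (\<lambda>x. (if x \<in> Z then F x else 0) * (if x \<in> Z then G x else 0))"
      using mult by (intro assms(5)) (auto simp: coord_ring_def)
    also have "(\<lambda>x. (if x \<in> Z then F x else 0) * (if x \<in> Z then G x else 0)) =
        (\<lambda>x. if x \<in> Z then F x * G x else 0)"
      by auto
    finally show ?case .
  qed (use assms in auto)
  then show ?thesis using F(2) by simp
qed

section \<open>Derivations and local nilpotency\<close>

lemma derivationD:
  assumes "derivation Z D" "f \<in> coord_ring Z"
  shows derivation_closed: "D f \<in> coord_ring Z"
    and derivation_add: "g \<in> coord_ring Z \<Longrightarrow> D (\<lambda>x. f x + g x) = (\<lambda>x. D f x + D g x)"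
    and derivation_cmult: "D (\<lambda>x. c * f x) = (\<lambda>x. c * D f x)"
    and derivation_mult: "g \<in> coord_ring Z \<Longrightarrow> D (\<lambda>x. f x * g x) = (\<lambda>x. D f x * g x + f x * D g x)"
  using assms unfolding derivation_def by blast+

lemma derivation_zero:
  assumes "derivation Z D"
  shows "D (\<lambda>_. 0) = (\<lambda>_. 0)"
  using derivation_cmult[OF assms coord_ring_zero, of 0] by simp

text \<open>The unit of the ring is the indicator \<open>e\<close> of \<open>Z\<close>. Idempotence
  gives \<open>D e = 2 e D e\<close>, which forces \<open>D e = 0\<close> on \<open>Z\<close>; off
  \<open>Z\<close> the value is 0 by convention.\<close>

lemma derivation_const:
  assumes D: "derivation Z D"
  shows "D (\<lambda>x. if x \<in> Z then c else 0) = (\<lambda>_. 0)"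
proof -
  define e :: "complex ^ 'a \<Rightarrow> complex" where "e = (\<lambda>x. if x \<in> Z then 1 else 0)"
  have e: "e \<in> coord_ring Z" unfolding e_def by (rule coord_ring_const)
  have "(\<lambda>x. e x * e x) = e" by (auto simp: e_def)
  then have *: "D e = (\<lambda>x. D e x * e x + e x * D e x)"
    using derivation_mult[OF D e e] by simp
  have "D e x = 0" for x
    using fun_cong[OF *, of x] coord_ring_outside[OF derivation_closed[OF D e], of x]
    by (cases "x \<in> Z") (auto simp: e_def)
  moreover have "(\<lambda>x. if x \<in> Z then c else 0) = (\<lambda>x. c * e x)"
    by (auto simp: e_def)
  ultimately show ?thesis
    using derivation_cmult[OF D e, of c] by auto
qed

lemma derivation_funpow_closed:
  assumes "derivation Z D" "f \<in> coord_ring Z"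
  shows "(D ^^ k) f \<in> coord_ring Z"
  using assms by (induction k) (auto intro: derivation_closed)

lemma derivation_funpow_zero:
  assumes "derivation Z D"
  shows "(D ^^ k) (\<lambda>_. 0) = (\<lambda>_. 0)"
  using derivation_zero[OF assms] by (induction k) auto

lemma derivation_funpow_add:
  assumes D: "derivation Z D" and "f \<in> coord_ring Z" "g \<in> coord_ring Z"
  shows "(D ^^ k) (\<lambda>x. f x + g x) = (\<lambda>x. (D ^^ k) f x + (D ^^ k) g x)"
  using assms
  by (induction k) (auto simp: derivation_add[OF D] derivation_funpow_closed)

lemma derivation_funpow_mono:
  assumes D: "derivation Z D" and "(D ^^ k) f = (\<lambda>_. 0)" "k \<le> l"
  shows "(D ^^ l) f = (\<lambda>_. 0)"
proof -
  have "(D ^^ l) f = (D ^^ (l - k)) ((D ^^ k) f)"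
    using assms(3) by (metis comp_apply funpow_add le_add_diff_inverse2)
  then show ?thesis using assms(2) derivation_funpow_zero[OF D] by simp
qed

text \<open>Induction on \<open>k + l\<close> replaces the binomial Leibniz formula: one application
  of \<open>D\<close> splits the product into two, each with one exponent lowered. If an exponent is
  0, that factor is itself zero.\<close>

lemma derivation_nilpotent_mult:
  assumes D: "derivation Z D" and "f \<in> coord_ring Z" "g \<in> coord_ring Z"
    and "(D ^^ k) f = (\<lambda>_. 0)" "(D ^^ l) g = (\<lambda>_. 0)"
  shows "(D ^^ (k + l)) (\<lambda>x. f x * g x) = (\<lambda>_. 0)"
  using assms(2-)
proof (induction "k + l" arbitrary: k l f g)
  case 0
  then show ?case by auto
next
  case (Suc n)
  note f = Suc.prems(1) and g = Suc.prems(2)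
  have Df: "D f \<in> coord_ring Z" and Dg: "D g \<in> coord_ring Z"
    using derivation_closed[OF D] f g by auto
  show ?case
  proof (cases "k = 0 \<or> l = 0")
    case True
    then have "(\<lambda>x. f x * g x) = (\<lambda>_. 0)"
      using Suc.prems by (auto simp: fun_eq_iff)
    then show ?thesis using derivation_funpow_zero[OF D] by simp
  next
    case False
    then obtain k' l' where kl: "k = Suc k'" "l = Suc l'"
      by (metis not0_implies_Suc)
    have "(D ^^ n) (\<lambda>x. D f x * g x) = (\<lambda>_. 0)"
      using Suc.hyps(1)[of k' l "D f" g] Suc.hyps(2) Suc.prems kl Df
      by (simp add: funpow_swap1)
    moreover have "(D ^^ n) (\<lambda>x. f x * D g x) = (\<lambda>_. 0)"
      using Suc.hyps(1)[of k l' f "D g"] Suc.hyps(2) Suc.prems kl Dg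
      by (simp add: funpow_swap1)
    ultimately have "(D ^^ n) (D (\<lambda>x. f x * g x)) = (\<lambda>_. 0)"
      using derivation_funpow_add[OF D coord_ring_mult[OF Df g] coord_ring_mult[OF f Dg], of n]
      by (simp add: derivation_mult[OF D f g])
    then show ?thesis
      unfolding Suc.hyps(2)[symmetric] by (simp add: funpow_swap1)
  qed
qed

text \<open>The functions killed by some power of \<open>D\<close> form a subalgebra containing the
  constants, so it suffices to test the generators of the ring.\<close>

lemma locally_nilpotent_derivationI:
  assumes D: "derivation Z D"
    and coord: "\<And>i. \<exists>k. (D ^^ k) (\<lambda>x. if x \<in> Z then x $ i else 0) = (\<lambda>_. 0)"
  shows "locally_nilpotent_derivation Z D"
proof -
  have "\<exists>k. (D ^^ k) f = (\<lambda>_. 0)" if "f \<in> coord_ring Z" for f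
    using that
  proof (induction rule: coord_ring_induct)
    case (const c)
    show ?case using derivation_const[OF D, of c] by (intro exI[of _ 1]) simp
  next
    case (add f g)
    then obtain k l where kl: "(D ^^ k) f = (\<lambda>_. 0)" "(D ^^ l) g = (\<lambda>_. 0)" by blast
    have "(D ^^ (k + l)) f = (\<lambda>_. 0)" "(D ^^ (k + l)) g = (\<lambda>_. 0)"
      using kl by (auto intro: derivation_funpow_mono[OF D])
    then show ?case
      using derivation_funpow_add[OF D add(1,2), of "k + l"] by auto
  next
    case (mult f g)
    then show ?case using derivation_nilpotent_mult[OF D] by blast
  qed (rule coord)
  then show ?thesis using D by (simp add: locally_nilpotent_derivation_def)
qed

section \<open>Flows\<close>

lemma is_flowD:
  assumes "is_flow Z D \<phi>" "p \<in> Z"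
  shows flow_in: "\<phi> t p \<in> Z"
    and flow_0: "\<phi> 0 p = p"
    and flow_add: "\<phi> (s + t) p = \<phi> s (\<phi> t p)"
    and flow_deriv_0: "f \<in> coord_ring Z \<Longrightarrow> ((\<lambda>t. f (\<phi> t p)) has_field_derivative D f p) (at 0)"
proof -
  have "(\<forall>t. \<phi> t p \<in> Z) \<and> \<phi> 0 p = p \<and> (\<forall>s t. \<phi> (s + t) p = \<phi> s (\<phi> t p)) \<and>
      (\<forall>f\<in>coord_ring Z. ((\<lambda>t. f (\<phi> t p)) has_field_derivative D f p) (at 0))"
    using assms unfolding is_flow_def by (rule bspec)
  then show "\<phi> t p \<in> Z" "\<phi> 0 p = p" "\<phi> (s + t) p = \<phi> s (\<phi> t p)"
    "f \<in> coord_ring Z \<Longrightarrow> ((\<lambda>t. f (\<phi> t p)) has_field_derivative D f p) (at 0)"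
    by simp_all
qed

lemma flow_deriv:
  assumes fl: "is_flow Z D \<phi>" and p: "p \<in> Z" and f: "f \<in> coord_ring Z"
  shows "((\<lambda>t. f (\<phi> t p)) has_field_derivative D f (\<phi> t p)) (at t)"
proof -
  have "((\<lambda>s. f (\<phi> s (\<phi> t p))) has_field_derivative D f (\<phi> t p)) (at 0)"
    using flow_deriv_0[OF fl flow_in[OF fl p] f] .
  then have "((\<lambda>s. f (\<phi> (s + t) p)) has_field_derivative D f (\<phi> t p)) (at 0)"
    by (simp add: flow_add[OF fl p])
  then show ?thesis
    using DERIV_shift[of "\<lambda>s. f (\<phi> s p)" _ 0 t] by simp
qed

lemma flow_continuous:
  assumes fl: "is_flow Z D \<phi>" and p: "p \<in> Z"
  shows "isCont (\<lambda>t. \<phi> t p) t"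
proof -
  have "isCont (\<lambda>t. \<phi> t p $ i) t" for i
    using DERIV_isCont[OF flow_deriv[OF fl p coord_ring_coord[of Z i]]] flow_in[OF fl p]
    by simp
  then show ?thesis
    unfolding continuous_at by (intro vec_tendstoI) (auto simp: continuous_at)
qed

lemma flow_minus:
  assumes "is_flow Z D \<phi>" "p \<in> Z"
  shows "\<phi> (- t) (\<phi> t p) = p"
  using flow_add[OF assms, of "-t" t] flow_0[OF assms] by simp

text \<open>If the vector field vanishes at \<open>p\<close>, all iterated derivatives of a regular function
  vanish there, and these are the Taylor coefficients of its polynomial restriction to the orbit.\<close>
lemma flow_fixed:
  assumes lnd: "locally_nilpotent_derivation Z D" and fl: "is_flow Z D \<phi>" and p: "p \<in> Z"
    and zero: "\<And>f. f \<in> coord_ring Z \<Longrightarrow> D f p = 0"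
  shows "\<phi> t p = p"
proof -
  have D: "derivation Z D" using lnd by (simp add: locally_nilpotent_derivation_def)
  have *: "\<forall>t. f (\<phi> t p) = f p" if "f \<in> coord_ring Z" "(D ^^ k) f = (\<lambda>_. 0)" for f k
    using that
  proof (induction k arbitrary: f)
    case (Suc k)
    \<comment> \<open>One application of \<open>D\<close> lowers the nilpotency order, so by
      induction \<open>D f\<close> is constant along the orbit, and its value at \<open>p\<close> is
      0.\<close>
    have "D f (\<phi> t p) = 0" for t
      using Suc.IH[of "D f"] Suc.prems derivation_closed[OF D] zero
      by (simp add: funpow_swap1)
    then have "((\<lambda>t. f (\<phi> t p)) has_field_derivative 0) (at t)" for t
      using flow_deriv[OF fl p Suc.prems(1), of t] by simp
    then obtain c where "f (\<phi> t p) = c" for t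
      using has_field_derivative_zero_constant[OF convex_UNIV, of "\<lambda>t. f (\<phi> t p)"] by auto
    then show ?case using flow_0[OF fl p] by metis
  qed auto
  have "\<phi> t p $ i = p $ i" for i
  proof -
    obtain k where "(D ^^ k) (\<lambda>x. if x \<in> Z then x $ i else 0) = (\<lambda>_. 0)"
      using lnd coord_ring_coord unfolding locally_nilpotent_derivation_def by blast
    from *[OF coord_ring_coord this] show ?thesis
      using p flow_in[OF fl p] by simp
  qed
  then show ?thesis by (simp add: vec_eq_iff)
qed

text \<open>A point that moves at some time is not a zero of the vector field, so some regular
  function has nonzero derivative along the orbit at time 0. This converts motion at an arbitrary
  time into motion at all small nonzero times, as the perturbation of base points requires.\<close>

lemma flow_locally_free:
  assumes lnd: "locally_nilpotent_derivation Z D" and fl: "is_flow Z D \<phi>" and p: "p \<in> Z"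
    and moves: "\<phi> s p \<noteq> p"
  shows "\<forall>\<^sub>F t in at 0. \<phi> t p \<noteq> p"
proof -
  obtain f where f: "f \<in> coord_ring Z" "D f p \<noteq> 0"
    using flow_fixed[OF lnd fl p] moves by blast
  have "((\<lambda>t. (f (\<phi> t p) - f p) / t) \<longlongrightarrow> D f p) (at 0)"
    using flow_deriv_0[OF fl p f(1)] flow_0[OF fl p] by (simp add: has_field_derivative_iff)
  then have "\<forall>\<^sub>F t in at 0. (f (\<phi> t p) - f p) / t \<noteq> 0"
    using f(2) by (rule tendsto_imp_eventually_ne)
  then show ?thesis by (rule eventually_mono) auto
qed

text \<open>The orbit is a continuous image of the complex plane, and a finite connected set is a
  single point. Infinitude of \<open>Z\<close> later provides room for auxiliary positions.\<close>

lemma infinite_if_flow_moves: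
  assumes fl: "is_flow Z D \<phi>" and p: "p \<in> Z" and moves: "\<phi> s p \<noteq> p"
  shows "infinite Z"
proof
  assume "finite Z"
  have "connected (range (\<lambda>t. \<phi> t p))"
    using flow_continuous[OF fl p]
    by (intro connected_continuous_image connected_UNIV) (simp add: continuous_on_eq_continuous_at)
  moreover have "finite (range (\<lambda>t. \<phi> t p))"
    using flow_in[OF fl p] by (intro finite_subset[OF _ \<open>finite Z\<close>]) auto
  ultimately obtain c where "range (\<lambda>t. \<phi> t p) = {c}"
    using connected_finite_iff_sing by (metis UNIV_not_empty image_is_empty)
  then have "\<phi> s p = \<phi> 0 p"
    by (metis rangeI singletonD)
  then show False
    using moves flow_0[OF fl p] by simp
qed

section \<open>The group generated by flows\<close>

lemma flow_restrict_Bij: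
  assumes fl: "is_flow Z D \<phi>"
  shows "restrict (\<phi> t) Z \<in> Bij Z"
proof -
  have "bij_betw (\<phi> t) Z Z"
  proof (rule bij_betwI[of _ _ _ "\<phi> (- t)"])
    show "\<phi> t (\<phi> (- t) y) = y" if "y \<in> Z" for y
      using flow_minus[OF fl that, of "- t"] by simp
  qed (auto simp: flow_in[OF fl] flow_minus[OF fl])
  then show ?thesis
    by (simp add: Bij_def)
qed

lemma flow_group_generators:
  "{restrict (\<phi> t) Z | \<phi> t. \<exists>D\<in>S. is_flow Z D \<phi>} \<subseteq> carrier (BijGroup Z)"
  using flow_restrict_Bij by (auto simp: BijGroup_def)

lemma flow_group_subset_Bij: "g \<in> flow_group Z S \<Longrightarrow> g \<in> Bij Z"
  using group.generate_in_carrier[OF group_BijGroup flow_group_generators]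
  unfolding flow_group_def by (fastforce simp: BijGroup_def)

lemma flow_group_in: "g \<in> flow_group Z S \<Longrightarrow> x \<in> Z \<Longrightarrow> g x \<in> Z"
  using flow_group_subset_Bij Bij_imp_funcset by fastforce

lemma flow_group_inj: "g \<in> flow_group Z S \<Longrightarrow> inj_on g Z"
  using flow_group_subset_Bij by (auto simp: Bij_def bij_betw_def)

lemma flow_group_id: "(\<lambda>x\<in>Z. x) \<in> flow_group Z S"
  using generate.one[of "BijGroup Z"] unfolding flow_group_def by (simp add: BijGroup_def)

lemma flow_group_flow: "D \<in> S \<Longrightarrow> is_flow Z D \<phi> \<Longrightarrow> restrict (\<phi> t) Z \<in> flow_group Z S"
  unfolding flow_group_def by (intro generate.incl) blast

lemma flow_group_compose:
  assumes "g \<in> flow_group Z S" "h \<in> flow_group Z S"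
  shows "compose Z g h \<in> flow_group Z S"
  using generate.eng[of g "BijGroup Z" _ h] assms flow_group_subset_Bij[OF assms(1)]
    flow_group_subset_Bij[OF assms(2)]
  unfolding flow_group_def by (simp add: BijGroup_def)

lemma flow_group_inverse:
  assumes g: "g \<in> flow_group Z S"
  obtains h where "h \<in> flow_group Z S" "\<And>x. x \<in> Z \<Longrightarrow> h (g x) = x"
proof
  let ?h = "\<lambda>x\<in>Z. inv_into Z g x"
  show "?h \<in> flow_group Z S"
    using group.generate_m_inv_closed[OF group_BijGroup flow_group_generators] g
      inv_BijGroup[OF flow_group_subset_Bij[OF g]]
    unfolding flow_group_def by fastforce
  show "?h (g x) = x" if "x \<in> Z" for x
    using that flow_group_in[OF g that] flow_group_inj[OF g] by simp
qed

text \<open>No case for inverses arises: the inverse of the time \<open>t\<close> map of a flow is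
  its time \<open>- t\<close> map.\<close>

lemma flow_group_induct [consumes 1, case_names id flow compose]:
  assumes "g \<in> flow_group Z S"
    and id: "P (\<lambda>x\<in>Z. x)"
    and flow: "\<And>D \<phi> t. D \<in> S \<Longrightarrow> is_flow Z D \<phi> \<Longrightarrow> P (restrict (\<phi> t) Z)"
    and compose: "\<And>g h. g \<in> flow_group Z S \<Longrightarrow> h \<in> flow_group Z S \<Longrightarrow> P g \<Longrightarrow> P h \<Longrightarrow>
      P (compose Z g h)"
  shows "P g"
  using assms(1) unfolding flow_group_def
proof (induction rule: generate.induct)
  case one
  then show ?case using id by (simp add: BijGroup_def restrict_def)
next
  case (incl h)
  then show ?case using flow by blast
next
  case (inv h)
  then obtain D \<phi> t where D: "D \<in> S" and fl: "is_flow Z D \<phi>" and h: "h = restrict (\<phi> t) Z"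
    by blast
  have B: "h \<in> Bij Z" using flow_restrict_Bij[OF fl] h by simp
  have "inv_into Z h x = \<phi> (- t) x" if "x \<in> Z" for x
  proof (rule inv_into_f_eq)
    show "inj_on h Z" using B by (auto simp: Bij_def bij_betw_def)
    show "\<phi> (- t) x \<in> Z" using flow_in[OF fl that] .
    then show "h (\<phi> (- t) x) = x" using flow_minus[OF fl that, of "- t"] h by simp
  qed
  then have "inv\<^bsub>BijGroup Z\<^esub> h = restrict (\<phi> (- t)) Z"
    using inv_BijGroup[OF B] by (auto intro!: restrict_ext)
  then show ?case using flow[OF D fl, of "- t"] by (simp only:)
next
  case (eng g h)
  then have "g \<in> flow_group Z S" "h \<in> flow_group Z S"
    unfolding flow_group_def by auto
  with eng show ?case
    using compose flow_group_subset_Bij by (fastforce simp: BijGroup_def)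
qed

text \<open>Otherwise every generator fixes \<open>p\<close>, hence so does the whole group.\<close>

lemma flow_moves_if_transitive:
  assumes "m_transitive Z (flow_group Z S) 1" "p \<in> Z" "q \<in> Z" "p \<noteq> q"
  obtains D \<phi> t where "D \<in> S" "is_flow Z D \<phi>" "\<phi> t p \<noteq> p"
proof -
  obtain g where g: "g \<in> flow_group Z S" "map g [p] = [q]"
    using assms unfolding m_transitive_def
    by (metis One_nat_def distinct_singleton empty_set insert_subset length_Cons list.set(2) list.size(3)
        empty_subsetI)
  have "g p = p" if "\<And>D \<phi> t. D \<in> S \<Longrightarrow> is_flow Z D \<phi> \<Longrightarrow> \<phi> t p = p"
    using g(1) by (induction rule: flow_group_induct) (use \<open>p \<in> Z\<close> that in \<open>auto simp: compose_def\<close>)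
  then show thesis using g(2) assms(4) that by auto
qed

section \<open>Group elements acting on indexed tuples\<close>

text \<open>Tuples are functions on indices below \<open>m\<close> rather than lists, so that base
  and fibre coordinates can be varied independently and a single entry changed by function
  update.\<close>

definition linked :: "('a \<Rightarrow> 'a) set \<Rightarrow> nat \<Rightarrow> (nat \<Rightarrow> 'a) \<Rightarrow> (nat \<Rightarrow> 'a) \<Rightarrow> bool" where
  "linked G m x y \<longleftrightarrow> (\<exists>g\<in>G. \<forall>i<m. g (x i) = y i)"

lemma linked_trans:
  assumes "linked (flow_group Z S) m x y" "linked (flow_group Z S) m y z" "\<And>i. i < m \<Longrightarrow> x i \<in> Z"
  shows "linked (flow_group Z S) m x z"
proof -
  obtain g h where "g \<in> flow_group Z S" "\<forall>i<m. g (x i) = y i"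
    "h \<in> flow_group Z S" "\<forall>i<m. h (y i) = z i"
    using assms(1,2) unfolding linked_def by blast
  then show ?thesis unfolding linked_def
    using assms(3) by (intro bexI[OF _ flow_group_compose[of h Z S g]]) (auto simp: compose_def)
qed

lemma linked_sym:
  assumes "linked (flow_group Z S) m x y" "\<And>i. i < m \<Longrightarrow> x i \<in> Z"
  shows "linked (flow_group Z S) m y x"
proof -
  obtain g where g: "g \<in> flow_group Z S" "\<forall>i<m. g (x i) = y i"
    using assms(1) unfolding linked_def by blast
  obtain h where "h \<in> flow_group Z S" "\<And>x. x \<in> Z \<Longrightarrow> h (g x) = x"
    using flow_group_inverse[OF g(1)] by blast
  then show ?thesis unfolding linked_def using assms(2) g(2) by metis
qed

lemma linked_refl:
  assumes "\<And>i. i < m \<Longrightarrow> x i \<in> Z" "\<And>i. i < m \<Longrightarrow> x i = y i"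
  shows "linked (flow_group Z S) m x y"
  unfolding linked_def using assms by (intro bexI[OF _ flow_group_id]) auto

lemma m_transitive_linked:
  "m_transitive Z G m \<longleftrightarrow>
    (\<forall>x y. x \<in> {..<m} \<rightarrow> Z \<and> y \<in> {..<m} \<rightarrow> Z \<and> inj_on x {..<m} \<and> inj_on y {..<m} \<longrightarrow> linked G m x y)"
    (is "_ \<longleftrightarrow> ?R")
proof
  assume tr: "m_transitive Z G m"
  show ?R
  proof (intro allI impI, elim conjE)
    fix x y :: "nat \<Rightarrow> 'a"
    assume *: "x \<in> {..<m} \<rightarrow> Z" "y \<in> {..<m} \<rightarrow> Z" "inj_on x {..<m}" "inj_on y {..<m}"
    have "distinct (map x [0..<m])" "distinct (map y [0..<m])"
      using * by (auto simp: distinct_map atLeast0LessThan)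
    moreover have "set (map x [0..<m]) \<subseteq> Z" "set (map y [0..<m]) \<subseteq> Z"
      using * by auto
    ultimately obtain g where g: "g \<in> G" "map g (map x [0..<m]) = map y [0..<m]"
      using tr unfolding m_transitive_def by (metis length_map length_upt minus_nat.diff_0)
    have "g (x i) = y i" if "i < m" for i
      using arg_cong[OF g(2), of "\<lambda>l. l ! i"] that by simp
    then show "linked G m x y" using g(1) unfolding linked_def by blast
  qed
next
  assume R: ?R
  show "m_transitive Z G m"
    unfolding m_transitive_def
  proof (intro allI impI, elim conjE)
    fix xs ys :: "'a list"
    assume *: "length xs = m" "length ys = m" "distinct xs" "distinct ys" "set xs \<subseteq> Z" "set ys \<subseteq> Z"
    then have "linked G m ((!) xs) ((!) ys)"
      using R by (auto simp: inj_on_def nth_eq_iff_index_eq Pi_iff subset_iff)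
    then obtain g where "g \<in> G" "\<forall>i<m. g (xs ! i) = ys ! i"
      unfolding linked_def by blast
    then show "\<exists>g\<in>G. map g xs = ys"
      using * by (intro bexI[of _ g] nth_equalityI) auto
  qed
qed

section \<open>The product with a line\<close>

definition line_pt :: "complex ^ 'n::finite \<Rightarrow> complex \<Rightarrow> complex ^ 'n option" where
  "line_pt z w = (\<chi> i. case i of None \<Rightarrow> w | Some j \<Rightarrow> z $ j)"

definition base :: "complex ^ 'n::finite option \<Rightarrow> complex ^ 'n" where
  "base x = (\<chi> j. x $ Some j)"

lemma line_pt_simps [simp]:
  "base (line_pt z w) = z" "line_pt z w $ None = w" "line_pt z w $ Some j = z $ j"
  "line_pt (base x) (x $ None) = x" "base x $ j = x $ Some j"
  by (auto simp: line_pt_def base_def vec_eq_iff split: option.split)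

lemma line_pt_eq_iff [simp]: "line_pt z w = line_pt z' w' \<longleftrightarrow> z = z' \<and> w = w'"
  by (metis line_pt_simps(1,2))

lemma mem_times_line: "x \<in> times_line Z \<longleftrightarrow> base x \<in> Z"
proof
  assume "x \<in> times_line Z"
  then show "base x \<in> Z" by (auto simp: times_line_def simp flip: line_pt_def)
next
  assume "base x \<in> Z"
  then show "x \<in> times_line Z"
    unfolding times_line_def
    by (intro image_eqI[of _ _ "(base x, x $ None)"]) (auto simp flip: line_pt_def)
qed

lemma coord_ring_slice:
  assumes "f \<in> coord_ring (times_line Z)"
  shows "(\<lambda>z. f (line_pt z w)) \<in> coord_ring Z"
  using assms
proof (induction rule: coord_ring_induct)
  case (const c)
  then show ?case using coord_ring_const[of Z c] by (simp add: mem_times_line)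
next
  case (coord i)
  then show ?case using coord_ring_const[of Z w] coord_ring_coord[of Z]
    by (cases i) (auto simp: mem_times_line cong: if_cong)
qed (auto intro: coord_ring_add coord_ring_mult)

lemma coord_ring_pullback:
  assumes "f \<in> coord_ring Z"
  shows "(\<lambda>x. f (base x)) \<in> coord_ring (times_line Z)"
  using assms
proof (induction rule: coord_ring_induct)
  case (const c)
  then show ?case using coord_ring_const[of "times_line Z" c] by (simp add: mem_times_line)
next
  case (coord i)
  then show ?case using coord_ring_coord[of "times_line Z" "Some i"]
    by (auto simp: mem_times_line cong: if_cong)
qed (auto intro: coord_ring_add coord_ring_mult)

section \<open>Weighted lifts of derivations and their flows\<close>

text \<open>The vector field \<open>q(w) D\<close>, tangent to the slices of constant
  \<open>w\<close>: the fibre coordinate is frozen, \<open>D\<close> acts on the resulting function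
  on \<open>Z\<close>, and the weight multiplies the result.\<close>

definition lift_deriv ::
    "(complex \<Rightarrow> complex) \<Rightarrow> ((complex ^ 'n::finite \<Rightarrow> complex) \<Rightarrow> (complex ^ 'n \<Rightarrow> complex)) \<Rightarrow>
      (complex ^ 'n option \<Rightarrow> complex) \<Rightarrow> (complex ^ 'n option \<Rightarrow> complex)" where
  "lift_deriv q D f = (\<lambda>x. q (x $ None) * D (\<lambda>z. f (line_pt z (x $ None))) (base x))"

lemma lift_deriv_separated:
  assumes "derivation Z D" "f \<in> coord_ring Z"
  shows "lift_deriv q D (\<lambda>x. r (x $ None) * f (base x)) =
    (\<lambda>x. q (x $ None) * r (x $ None) * D f (base x))"
  unfolding lift_deriv_def by (simp add: derivation_cmult[OF assms] mult.assoc)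

lemma lift_deriv_add:
  assumes "derivation Z D" "f \<in> coord_ring (times_line Z)" "g \<in> coord_ring (times_line Z)"
  shows "lift_deriv q D (\<lambda>x. f x + g x) = (\<lambda>x. lift_deriv q D f x + lift_deriv q D g x)"
  unfolding lift_deriv_def
  by (simp add: derivation_add[OF assms(1) coord_ring_slice[OF assms(2)] coord_ring_slice[OF assms(3)]]
      algebra_simps)

lemma lift_deriv_mult:
  assumes "derivation Z D" "f \<in> coord_ring (times_line Z)" "g \<in> coord_ring (times_line Z)"
  shows "lift_deriv q D (\<lambda>x. f x * g x) = (\<lambda>x. lift_deriv q D f x * g x + f x * lift_deriv q D g x)"
  unfolding lift_deriv_def
  by (simp add: derivation_mult[OF assms(1) coord_ring_slice[OF assms(2)] coord_ring_slice[OF assms(3)]]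
      algebra_simps)

lemma lift_deriv_coord_Some:
  "lift_deriv q D (\<lambda>x. if x \<in> times_line Z then x $ Some j else 0) =
    (\<lambda>x. q (x $ None) * D (\<lambda>z. if z \<in> Z then z $ j else 0) (base x))"
  unfolding lift_deriv_def by (simp add: mem_times_line cong: if_cong)

lemma lift_deriv_coord_None:
  assumes "derivation Z D"
  shows "lift_deriv q D (\<lambda>x. if x \<in> times_line Z then x $ None else 0) = (\<lambda>_. 0)"
  unfolding lift_deriv_def by (simp add: mem_times_line derivation_const[OF assms] cong: if_cong)

lemma derivation_lift_deriv:
  fixes Z :: "(complex ^ 'n::finite) set"
  assumes D: "derivation Z D" and q: "(\<lambda>x :: complex ^ 'n option. q (x $ None)) \<in> poly_fun"
  shows "derivation (times_line Z) (lift_deriv q D)"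
  unfolding derivation_def
proof (intro conjI ballI allI)
  show "lift_deriv q D f \<in> coord_ring (times_line Z)" if "f \<in> coord_ring (times_line Z)" for f
    using that
  proof (induction rule: coord_ring_induct)
    case (const c)
    show ?case
      unfolding lift_deriv_def
      by (simp add: mem_times_line derivation_const[OF D] coord_ring_zero)
  next
    case (coord i)
    show ?case
    proof (cases i)
      case None
      show ?thesis unfolding None by (simp add: lift_deriv_coord_None[OF D] coord_ring_zero)
    next
      case (Some j)
      show ?thesis
        unfolding Some
        using coord_ring_poly_mult[OF q coord_ring_pullback[OF derivation_closed[OF D coord_ring_coord]]]
        by (simp add: lift_deriv_coord_Some)
    qed
  qed (simp_all add: lift_deriv_add[OF D] lift_deriv_mult[OF D] coord_ring_add coord_ring_mult)
  show "lift_deriv q D (\<lambda>x. c * f x) = (\<lambda>x. c * lift_deriv q D f x)"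
    if "f \<in> coord_ring (times_line Z)" for c f
    unfolding lift_deriv_def using derivation_cmult[OF D coord_ring_slice[OF that]] by auto
qed (use lift_deriv_add[OF D] lift_deriv_mult[OF D] in blast)+

text \<open>Because \<open>w\<close> is in the kernel, the weight behaves as a scalar: on functions
  pulled back from \<open>Z\<close> the \<open>k\<close>-th iterate is the \<open>k\<close>-th power
  of \<open>q\<close> times that of \<open>D\<close>. Each base coordinate thus dies with
  \<open>D\<close>, and \<open>w\<close> dies at once.\<close>

lemma locally_nilpotent_lift_deriv:
  fixes Z :: "(complex ^ 'n::finite) set"
  assumes lnd: "locally_nilpotent_derivation Z D"
    and q: "(\<lambda>x :: complex ^ 'n option. q (x $ None)) \<in> poly_fun"
  shows "locally_nilpotent_derivation (times_line Z) (lift_deriv q D)"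
proof -
  have D: "derivation Z D" using lnd by (simp add: locally_nilpotent_derivation_def)
  show ?thesis
  proof (rule locally_nilpotent_derivationI[OF derivation_lift_deriv[OF D q]])
    fix i :: "'n option"
    show "\<exists>k. (lift_deriv q D ^^ k) (\<lambda>x. if x \<in> times_line Z then x $ i else 0) = (\<lambda>_. 0)"
    proof (cases i)
      case None
      show ?thesis unfolding None using lift_deriv_coord_None[OF D, of q] by (intro exI[of _ 1]) simp
    next
      case (Some j)
      define f where "f = (\<lambda>z. if z \<in> Z then z $ j else 0)"
      have f: "f \<in> coord_ring Z" unfolding f_def by (rule coord_ring_coord)
      have pow: "(lift_deriv q D ^^ k) (\<lambda>x. f (base x)) = (\<lambda>x. q (x $ None) ^ k * (D ^^ k) f (base x))"
        for k
      proof (induction k)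
        case (Suc k)
        then show ?case
          using lift_deriv_separated[OF D derivation_funpow_closed[OF D f], of q "\<lambda>w. q w ^ k" k] by simp
      qed simp
      obtain k where "(D ^^ k) f = (\<lambda>_. 0)"
        using lnd f unfolding locally_nilpotent_derivation_def by blast
      then have "(lift_deriv q D ^^ k) (\<lambda>x. f (base x)) = (\<lambda>_. 0)"
        by (simp add: pow)
      then show ?thesis unfolding Some by (auto simp: f_def mem_times_line cong: if_cong)
    qed
  qed
qed

text \<open>Along an orbit \<open>w\<close> is constant, so the weight only rescales time by the
  factor \<open>q w\<close>.\<close>

lemma is_flow_lift_deriv:
  assumes fl: "is_flow Z D \<phi>"
  shows "is_flow (times_line Z) (lift_deriv q D)
    (\<lambda>t x. line_pt (\<phi> (t * q (x $ None)) (base x)) (x $ None))"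
  unfolding is_flow_def
proof (intro ballI conjI allI)
  fix x :: "complex ^ 'a option"
  assume "x \<in> times_line Z"
  then have p: "base x \<in> Z" by (simp add: mem_times_line)
  show "line_pt (\<phi> (t * q (x $ None)) (base x)) (x $ None) \<in> times_line Z" for t
    using flow_in[OF fl p] by (simp add: mem_times_line)
  show "line_pt (\<phi> (0 * q (x $ None)) (base x)) (x $ None) = x"
    using flow_0[OF fl p] by simp
  show "line_pt (\<phi> ((s + t) * q (x $ None)) (base x)) (x $ None) =
    line_pt (\<phi> (s * q (line_pt (\<phi> (t * q (x $ None)) (base x)) (x $ None) $ None))
      (base (line_pt (\<phi> (t * q (x $ None)) (base x)) (x $ None))))
      (line_pt (\<phi> (t * q (x $ None)) (base x)) (x $ None) $ None)" for s t
    using flow_add[OF fl p] by (simp add: distrib_right)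
  show "((\<lambda>t. f (line_pt (\<phi> (t * q (x $ None)) (base x)) (x $ None)))
      has_field_derivative lift_deriv q D f x) (at 0)" if "f \<in> coord_ring (times_line Z)" for f
  proof -
    let ?h = "\<lambda>z. f (line_pt z (x $ None))"
    have "((\<lambda>t. ?h (\<phi> t (base x))) has_field_derivative D ?h (base x)) (at (0 * q (x $ None)))"
      using flow_deriv_0[OF fl p coord_ring_slice[OF that]] by simp
    moreover have "((\<lambda>t. t * q (x $ None)) has_field_derivative q (x $ None)) (at 0)"
      by (auto intro!: derivative_eq_intros)
    ultimately have "((\<lambda>t. ?h (\<phi> (t * q (x $ None)) (base x))) has_field_derivative
        D ?h (base x) * q (x $ None)) (at 0)"
      by (rule DERIV_chain2)
    then show ?thesis by (simp add: lift_deriv_def mult.commute)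
  qed
qed

section \<open>Shears along the fibre\<close>

text \<open>The operator \<open>deriv\<close> obeys the sum and product rules only for
  differentiable functions. On a fibre a regular function is a polynomial in \<open>w\<close>, or 0
  when \<open>z\<close> is outside \<open>Z\<close>.\<close>

lemma coord_ring_fibre_differentiable:
  assumes "f \<in> coord_ring (times_line Z)"
  shows "(\<lambda>w. f (line_pt z w)) field_differentiable at w"
  using assms
proof (induction rule: coord_ring_induct)
  case (coord i)
  then show ?case by (cases i; cases "z \<in> Z") (auto simp: mem_times_line)
qed (auto simp: mem_times_line intro: field_differentiable_add field_differentiable_mult)

text \<open>The vector field \<open>z_l \<partial>/\<partial>w\<close>. The analytic derivative
  depends on the function alone, so no polynomial representative has to be chosen.\<close>

definition shear_deriv ::
    "'n::finite \<Rightarrow> (complex ^ 'n option \<Rightarrow> complex) \<Rightarrow> (complex ^ 'n option \<Rightarrow> complex)" where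
  "shear_deriv l f = (\<lambda>x. x $ Some l * deriv (\<lambda>w. f (line_pt (base x) w)) (x $ None))"

lemma shear_deriv_add:
  assumes "f \<in> coord_ring (times_line Z)" "g \<in> coord_ring (times_line Z)"
  shows "shear_deriv l (\<lambda>x. f x + g x) = (\<lambda>x. shear_deriv l f x + shear_deriv l g x)"
  unfolding shear_deriv_def
  by (simp add: coord_ring_fibre_differentiable[OF assms(1)]
      coord_ring_fibre_differentiable[OF assms(2)] distrib_left)

lemma shear_deriv_mult:
  assumes "f \<in> coord_ring (times_line Z)" "g \<in> coord_ring (times_line Z)"
  shows "shear_deriv l (\<lambda>x. f x * g x) = (\<lambda>x. shear_deriv l f x * g x + f x * shear_deriv l g x)"
  unfolding shear_deriv_def
  by (simp add: coord_ring_fibre_differentiable[OF assms(1)]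
      coord_ring_fibre_differentiable[OF assms(2)] algebra_simps)

lemma shear_deriv_const: "shear_deriv l (\<lambda>x. if x \<in> times_line Z then c else 0) = (\<lambda>_. 0)"
  unfolding shear_deriv_def by (simp add: mem_times_line)

lemma shear_deriv_coord_Some:
  "shear_deriv l (\<lambda>x. if x \<in> times_line Z then x $ Some j else 0) = (\<lambda>_. 0)"
  unfolding shear_deriv_def by (simp add: mem_times_line cong: if_cong)

lemma shear_deriv_coord_None:
  "shear_deriv l (\<lambda>x. if x \<in> times_line Z then x $ None else 0) =
    (\<lambda>x. if x \<in> times_line Z then x $ Some l else 0)"
  unfolding shear_deriv_def by (auto simp: mem_times_line fun_eq_iff cong: if_cong)

lemma derivation_shear_deriv: "derivation (times_line Z) (shear_deriv l)"
  unfolding derivation_def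
proof (intro conjI ballI allI)
  show "shear_deriv l f \<in> coord_ring (times_line Z)" if "f \<in> coord_ring (times_line Z)" for f
    using that
  proof (induction rule: coord_ring_induct)
    case (const c)
    then show ?case by (simp add: shear_deriv_const coord_ring_zero)
  next
    case (coord i)
    show ?case
      by (cases i; hypsubst)
        (simp_all add: shear_deriv_coord_None shear_deriv_coord_Some coord_ring_zero coord_ring_coord)
  qed (simp_all add: shear_deriv_add shear_deriv_mult coord_ring_add coord_ring_mult)
  show "shear_deriv l (\<lambda>x. c * f x) = (\<lambda>x. c * shear_deriv l f x)"
    if "f \<in> coord_ring (times_line Z)" for c f
    unfolding shear_deriv_def
    by (simp add: coord_ring_fibre_differentiable[OF that] mult.left_commute)
qed (use shear_deriv_add shear_deriv_mult in blast)+

text \<open>The coordinate \<open>w\<close> goes to the \<open>l\<close>-th base coordinate, which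
  goes to 0; hence the exponent 2.\<close>

lemma locally_nilpotent_shear_deriv: "locally_nilpotent_derivation (times_line Z) (shear_deriv l)"
proof (rule locally_nilpotent_derivationI[OF derivation_shear_deriv])
  fix i :: "'a option"
  show "\<exists>k. (shear_deriv l ^^ k) (\<lambda>x. if x \<in> times_line Z then x $ i else 0) = (\<lambda>_. 0)"
    by (intro exI[of _ 2], cases i; hypsubst)
      (simp_all add: numeral_2_eq_2 shear_deriv_coord_None shear_deriv_coord_Some
        derivation_zero[OF derivation_shear_deriv])
qed

lemma is_flow_shear_deriv:
  "is_flow (times_line Z) (shear_deriv l)
    (\<lambda>t x. line_pt (base x) (x $ None + t * x $ Some l))"
  unfolding is_flow_def
proof (intro ballI conjI allI)
  fix x :: "complex ^ 'a option" and f
  assume "f \<in> coord_ring (times_line Z)"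
  then have "((\<lambda>w. f (line_pt (base x) w)) has_field_derivative
      deriv (\<lambda>w. f (line_pt (base x) w)) (x $ None)) (at (x $ None + 0 * x $ Some l))"
    using coord_ring_fibre_differentiable field_differentiable_derivI by fastforce
  moreover have "((\<lambda>t. x $ None + t * x $ Some l) has_field_derivative x $ Some l) (at 0)"
    by (auto intro!: derivative_eq_intros)
  ultimately have "((\<lambda>t. f (line_pt (base x) (x $ None + t * x $ Some l))) has_field_derivative
      deriv (\<lambda>w. f (line_pt (base x) w)) (x $ None) * x $ Some l) (at 0)"
    by (rule DERIV_chain2)
  then show "((\<lambda>t. f (line_pt (base x) (x $ None + t * x $ Some l))) has_field_derivative
      shear_deriv l f x) (at 0)"
    by (simp add: shear_deriv_def mult.commute)
qed (auto simp: mem_times_line algebra_simps)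

section \<open>Transitivity on the product\<close>

locale lifted_flows =
  fixes Z :: "(complex ^ 'n::finite) set"
    and S :: "((complex ^ 'n \<Rightarrow> complex) \<Rightarrow> (complex ^ 'n \<Rightarrow> complex)) set"
    and l :: 'n and a b :: "complex ^ 'n"
  assumes lnd: "\<And>D. D \<in> S \<Longrightarrow> locally_nilpotent_derivation Z D"
    and transitive: "\<And>m. m_transitive Z (flow_group Z S) m"
    and a: "a \<in> Z" and b: "b \<in> Z" and separated: "a $ l \<noteq> b $ l"
begin

definition lifts where
  "lifts = insert (shear_deriv l) (lift_deriv (\<lambda>_. 1) ` S \<union> lift_deriv (\<lambda>w. w) ` S)"

abbreviation G where "G \<equiv> flow_group (times_line Z) lifts"

lemma lifts_lnd:
  assumes "D \<in> lifts"
  shows "locally_nilpotent_derivation (times_line Z) D"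
proof -
  consider "D = shear_deriv l" | D' where "D' \<in> S" "D = lift_deriv (\<lambda>_. 1) D'"
    | D' where "D' \<in> S" "D = lift_deriv (\<lambda>w. w) D'"
    using assms unfolding lifts_def by blast
  then show ?thesis
    using locally_nilpotent_shear_deriv locally_nilpotent_lift_deriv[OF lnd poly_fun.const]
      locally_nilpotent_lift_deriv[OF lnd poly_fun.coord]
    by cases simp_all
qed

lemma moving_flow:
  assumes "p \<in> Z"
  obtains D \<phi> t where "D \<in> S" "is_flow Z D \<phi>" "\<phi> t p \<noteq> p"
proof -
  obtain q where "q \<in> Z" "p \<noteq> q" using a b separated by metis
  then show thesis using flow_moves_if_transitive[OF transitive assms] that by blast
qed

lemma infinite_base: "infinite Z"
proof -
  obtain D \<phi> t where "is_flow Z D \<phi>" "\<phi> t a \<noteq> a" using moving_flow[OF a] .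
  then show ?thesis using infinite_if_flow_moves a by blast
qed

text \<open>A word in the flows on \<open>Z\<close> is replaced letter by letter by the flows of the
  lifts of weight 1, which leave \<open>w\<close> alone.\<close>

lemma lift_group_element:
  assumes "g \<in> flow_group Z S"
  shows "\<exists>h\<in>G. \<forall>z\<in>Z. \<forall>w. h (line_pt z w) = line_pt (g z) w"
  using assms
proof (induction g rule: flow_group_induct)
  case id
  then show ?case by (intro bexI[OF _ flow_group_id]) (auto simp: mem_times_line)
next
  case (flow D \<phi> t)
  have "lift_deriv (\<lambda>_. 1) D \<in> lifts" using flow by (auto simp: lifts_def)
  from flow_group_flow[OF this is_flow_lift_deriv[OF flow(2)], of t] show ?case
    by (rule rev_bexI) (simp add: mem_times_line)
next
  case (compose g h)
  obtain g' where g': "g' \<in> G" "\<forall>z\<in>Z. \<forall>w. g' (line_pt z w) = line_pt (g z) w"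
    using compose(3) ..
  obtain h' where h': "h' \<in> G" "\<forall>z\<in>Z. \<forall>w. h' (line_pt z w) = line_pt (h z) w"
    using compose(4) ..
  have "compose (times_line Z) g' h' (line_pt z w) = line_pt (compose Z g h z) w" if "z \<in> Z" for z w
    using that g'(2) h'(2) flow_group_in[OF compose(2) that] by (simp add: compose_eq mem_times_line)
  then show ?case
    by (intro bexI[OF _ flow_group_compose[OF g'(1) h'(1)]] ballI allI)
qed

lemma move_base:
  assumes "z \<in> {..<m} \<rightarrow> Z" "z' \<in> {..<m} \<rightarrow> Z" "inj_on z {..<m}" "inj_on z' {..<m}"
  shows "linked G m (\<lambda>i. line_pt (z i) (w i)) (\<lambda>i. line_pt (z' i) (w i))"
proof -
  obtain g where g: "g \<in> flow_group Z S" "\<forall>i<m. g (z i) = z' i"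
    using transitive[of m] assms unfolding m_transitive_linked linked_def by blast
  obtain h where h: "h \<in> G" "\<forall>z\<in>Z. \<forall>w. h (line_pt z w) = line_pt (g z) w"
    using lift_group_element[OF g(1)] ..
  have "h (line_pt (z i) (w i)) = line_pt (z' i) (w i)" if "i < m" for i
    using h(2) g(2) assms(1) that by (auto simp: Pi_iff)
  then show ?thesis
    using h(1) unfolding linked_def by blast
qed

lemma shear:
  assumes "z \<in> {..<m} \<rightarrow> Z"
  shows "linked G m (\<lambda>i. line_pt (z i) (w i)) (\<lambda>i. line_pt (z i) (w i + t * z i $ l))"
proof -
  have "shear_deriv l \<in> lifts" by (simp add: lifts_def)
  from flow_group_flow[OF this is_flow_shear_deriv, of t] show ?thesis
    unfolding linked_def by (rule bexI[rotated]) (use assms in \<open>auto simp: mem_times_line\<close>)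
qed

text \<open>Shearing by \<open>t\<close> while the \<open>k\<close>-th point lies over \<open>a\<close>, and by \<open>- t\<close> while it lies over \<open>b\<close>
  with the other points unmoved, changes only the fibre coordinate of the \<open>k\<close>-th point.\<close>
lemma move_one_fibre:
  assumes z: "z \<in> {..<m} \<rightarrow> Z" "inj_on z {..<m}" and "k < m"
  shows "linked G m (\<lambda>i. line_pt (z i) (w i)) (\<lambda>i. line_pt (z i) ((w(k := c)) i))"
proof -
  \<comment> \<open>The values of \<open>s\<close> are parking positions for the other points;
    avoiding both \<open>a\<close> and \<open>b\<close> keeps the tuples \<open>y\<close> and
    \<open>y'\<close> injective.\<close>
  have "infinite (Z - {a, b})" using infinite_base by simp
  then obtain s :: "nat \<Rightarrow> complex ^ 'n" where s: "inj s" "range s \<subseteq> Z - {a, b}"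
    using infinite_countable_subset by blast
  have s': "s i \<in> Z" "s i \<noteq> a" "a \<noteq> s i" "s i \<noteq> b" "b \<noteq> s i" for i
    using s(2) by auto
  define y where "y = s(k := a)"
  define y' where "y' = s(k := b)"
  \<comment> \<open>Point \<open>k\<close> gains \<open>t\<close> times the \<open>l\<close>-th
    coordinate of \<open>a\<close> and loses \<open>t\<close> times that of \<open>b\<close>; this
    \<open>t\<close> makes the balance equal to \<open>c - w k\<close>.\<close>
  define t where "t = (c - w k) / (a $ l - b $ l)"
  define v where "v = (\<lambda>i. w i + t * y i $ l)"
  have y: "y \<in> {..<m} \<rightarrow> Z" "inj_on y {..<m}" and y': "y' \<in> {..<m} \<rightarrow> Z" "inj_on y' {..<m}"
    using a b injD[OF s(1)] s' by (auto simp: y_def y'_def inj_on_def)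
  have w: "(\<lambda>i. v i + (- t) * y' i $ l) = w(k := c)"
  proof
    fix i
    show "v i + (- t) * y' i $ l = (w(k := c)) i"
    proof (cases "i = k")
      case True
      have "t * (a $ l - b $ l) = c - w k"
        using separated by (simp add: t_def)
      then show ?thesis using True by (simp add: v_def y_def y'_def algebra_simps)
    qed (simp add: v_def y_def y'_def)
  qed
  note [trans] = linked_trans
  have "linked G m (\<lambda>i. line_pt (z i) (w i)) (\<lambda>i. line_pt (y i) (w i))"
    by (rule move_base[OF z(1) y(1) z(2) y(2)])
  also have "linked G m (\<lambda>i. line_pt (y i) (w i)) (\<lambda>i. line_pt (y i) (v i))"
    unfolding v_def by (rule shear[OF y(1)])
  also have "linked G m (\<lambda>i. line_pt (y i) (v i)) (\<lambda>i. line_pt (y' i) (v i))"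
    by (rule move_base[OF y(1) y'(1) y(2) y'(2)])
  also have "linked G m (\<lambda>i. line_pt (y' i) (v i)) (\<lambda>i. line_pt (y' i) (v i + (- t) * y' i $ l))"
    by (rule shear[OF y'(1)])
  also have "linked G m (\<lambda>i. line_pt (y' i) (v i + (- t) * y' i $ l))
      (\<lambda>i. line_pt (z i) ((w(k := c)) i))"
    unfolding w[symmetric] by (rule move_base[OF y'(1) z(1) y'(2) z(2)])
  finally show ?thesis
    using z by (auto simp: mem_times_line)
qed

lemma move_fibres:
  assumes z: "z \<in> {..<m} \<rightarrow> Z" "inj_on z {..<m}"
  shows "linked G m (\<lambda>i. line_pt (z i) (w i)) (\<lambda>i. line_pt (z i) (w' i))"
proof -
  have "linked G m (\<lambda>i. line_pt (z i) (w i)) (\<lambda>i. line_pt (z i) (if i < j then w' i else w i))"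
    if "j \<le> m" for j
    using that
  proof (induction j)
    case 0
    show ?case using z by (intro linked_refl) (auto simp: mem_times_line)
  next
    case (Suc j)
    let ?w = "\<lambda>i. if i < j then w' i else w i"
    have "?w(j := w' j) = (\<lambda>i. if i < Suc j then w' i else w i)"
      by (auto simp: less_Suc_eq)
    then have "linked G m (\<lambda>i. line_pt (z i) (?w i)) (\<lambda>i. line_pt (z i) (if i < Suc j then w' i else w i))"
      using move_one_fibre[OF z, of j ?w "w' j"] Suc.prems by simp
    moreover have "line_pt (z i) (w i) \<in> times_line Z" if "i < m" for i
      using z that by (auto simp: mem_times_line)
    ultimately show ?case
      using linked_trans[OF Suc.IH] Suc.prems by simp
  qed
  from this[of m] show ?thesis
    by (simp add: linked_def)
qed

text \<open>The flow of \<open>w D\<close> moves points over the same \<open>z\<close> at different speeds \<open>w\<close>. For small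
  time no new coincidences of base points arise, while an existing one is resolved.\<close>
lemma separate_bases:
  assumes "z \<in> {..<m} \<rightarrow> Z" "inj_on (\<lambda>i. line_pt (z i) (w i)) {..<m}"
  shows "\<exists>z'. z' \<in> {..<m} \<rightarrow> Z \<and> inj_on z' {..<m} \<and>
    linked G m (\<lambda>i. line_pt (z i) (w i)) (\<lambda>i. line_pt (z' i) (w i))"
  using assms
proof (induction "card {(i, j). i < m \<and> j < m \<and> i \<noteq> j \<and> z i = z j}" arbitrary: z rule: less_induct)
  case less
  let ?C = "\<lambda>z :: nat \<Rightarrow> complex ^ 'n. {(i, j). i < m \<and> j < m \<and> i \<noteq> j \<and> z i = z j}"
  have z: "z i \<in> Z" if "i < m" for i using less.prems that by auto
  show ?case
  proof (cases "inj_on z {..<m}")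
    case True
    then show ?thesis
      using less.prems by (intro exI[of _ z]) (auto intro!: linked_refl simp: mem_times_line)
  next
    case False
    then obtain i j where ij: "i < m" "j < m" "i \<noteq> j" "z i = z j"
      by (auto simp: inj_on_def)
    then have wij: "w i \<noteq> w j"
      using less.prems(2) by (auto simp: inj_on_def)
    obtain D \<phi> t0 where D: "D \<in> S" and fl: "is_flow Z D \<phi>" and t0: "\<phi> t0 (z i) \<noteq> z i"
      using moving_flow[OF z[OF ij(1)]] .
    have cont: "((\<lambda>t. \<phi> (t * c) p) \<longlongrightarrow> p) (at 0)" if "p \<in> Z" for p c
    proof -
      have "isCont (\<lambda>t. t * c) 0" "isCont (\<lambda>t. \<phi> t p) (0 * c)"
        using flow_continuous[OF fl that] by auto
      then have "isCont (\<lambda>t. \<phi> (t * c) p) 0" by (rule isCont_o2)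
      then show ?thesis using flow_0[OF fl that] by (simp add: isCont_def)
    qed
    \<comment> \<open>Pairs with different base points stay apart near time 0 by continuity; as
      there are finitely many, one time serves all of them.\<close>
    define Q where "Q = {p \<in> {..<m} \<times> {..<m}. z (fst p) \<noteq> z (snd p)}"
    have "finite Q" by (simp add: Q_def)
    have "\<forall>\<^sub>F t in at 0. \<phi> (t * w i') (z i') \<noteq> \<phi> (t * w j') (z j')"
      if "i' < m" "j' < m" "z i' \<noteq> z j'" for i' j'
    proof -
      have "((\<lambda>t. \<phi> (t * w i') (z i') - \<phi> (t * w j') (z j')) \<longlongrightarrow> z i' - z j') (at 0)"
        using that z by (intro tendsto_diff cont) auto
      then have "\<forall>\<^sub>F t in at 0. \<phi> (t * w i') (z i') - \<phi> (t * w j') (z j') \<noteq> 0"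
        using that by (intro tendsto_imp_eventually_ne) auto
      then show ?thesis by (rule eventually_mono) auto
    qed
    then have "\<forall>\<^sub>F t in at 0. \<forall>p\<in>Q. \<phi> (t * w (fst p)) (z (fst p)) \<noteq> \<phi> (t * w (snd p)) (z (snd p))"
      by (intro eventually_ball_finite[OF \<open>finite Q\<close>]) (auto simp: Q_def)
    \<comment> \<open>The two points share an orbit, run for times \<open>t * w i\<close> and
      \<open>t * w j\<close>. They could meet only if the time difference fixed \<open>z i\<close>,
      which local freeness rules out for small nonzero \<open>t\<close>.\<close>
    moreover have "\<forall>\<^sub>F t in at 0. \<phi> (t * w i) (z i) \<noteq> \<phi> (t * w j) (z i)"
    proof -
      have "filterlim (\<lambda>t. t * (w i - w j)) (at 0) (at 0)"
        using wij by (intro filterlim_atI) (auto intro!: tendsto_eq_intros simp: eventually_at_filter)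
      then have "\<forall>\<^sub>F t in at 0. \<phi> (t * (w i - w j)) (z i) \<noteq> z i"
        by (rule eventually_compose_filterlim[OF flow_locally_free[OF lnd[OF D] fl z[OF ij(1)] t0]])
      then show ?thesis
      proof (rule eventually_mono)
        fix t assume *: "\<phi> (t * (w i - w j)) (z i) \<noteq> z i"
        have "\<phi> (t * (w i - w j)) (z i) = \<phi> (- (t * w j)) (\<phi> (t * w i) (z i))"
          using flow_add[OF fl z[OF ij(1)], of "- (t * w j)" "t * w i"] by (simp add: algebra_simps)
        then show "\<phi> (t * w i) (z i) \<noteq> \<phi> (t * w j) (z i)"
          using * flow_minus[OF fl z[OF ij(1)]] by auto
      qed
    qed
    ultimately have "\<forall>\<^sub>F t in at 0.
        (\<forall>p\<in>Q. \<phi> (t * w (fst p)) (z (fst p)) \<noteq> \<phi> (t * w (snd p)) (z (snd p))) \<and>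
        \<phi> (t * w i) (z i) \<noteq> \<phi> (t * w j) (z i)"
      by (rule eventually_conj)
    then obtain t where tQ: "\<forall>p\<in>Q. \<phi> (t * w (fst p)) (z (fst p)) \<noteq> \<phi> (t * w (snd p)) (z (snd p))"
      and tij: "\<phi> (t * w i) (z i) \<noteq> \<phi> (t * w j) (z i)"
      using eventually_happens'[OF at_neq_bot] by blast
    have t: "\<phi> (t * w i') (z i') \<noteq> \<phi> (t * w j') (z j')" if "i' < m" "j' < m" "z i' \<noteq> z j'" for i' j'
      using bspec[OF tQ, of "(i', j')"] that by (simp add: Q_def)
    define y where "y = (\<lambda>i. \<phi> (t * w i) (z i))"
    have y: "y \<in> {..<m} \<rightarrow> Z" using flow_in[OF fl] z by (auto simp: y_def)
    have "?C y \<subseteq> ?C z" using t by (auto simp: y_def)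
    moreover have "(i, j) \<in> ?C z" "(i, j) \<notin> ?C y" using ij tij by (auto simp: y_def)
    ultimately have "?C y \<subset> ?C z" by blast
    moreover have "finite (?C z)" by (rule finite_subset[of _ "{..<m} \<times> {..<m}"]) auto
    ultimately have "card (?C y) < card (?C z)" by (rule psubset_card_mono[rotated])
    have "lift_deriv (\<lambda>w. w) D \<in> lifts" using D by (auto simp: lifts_def)
    from flow_group_flow[OF this is_flow_lift_deriv[OF fl], of t]
    have zy: "linked G m (\<lambda>i. line_pt (z i) (w i)) (\<lambda>i. line_pt (y i) (w i))"
      unfolding linked_def y_def by (rule bexI[rotated]) (use z in \<open>auto simp: mem_times_line\<close>)
    have "inj_on (\<lambda>i. line_pt (y i) (w i)) {..<m}"
    proof (rule inj_onI)
      fix i' j' assume "i' \<in> {..<m}" "j' \<in> {..<m}" "line_pt (y i') (w i') = line_pt (y j') (w j')"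
      moreover from this have "z i' = z j'" using t[of i' j'] by (fastforce simp: y_def)
      ultimately show "i' = j'" using less.prems(2) by (auto simp: inj_on_def)
    qed
    from less.hyps[OF \<open>card (?C y) < card (?C z)\<close> y this]
    obtain z' where z': "z' \<in> {..<m} \<rightarrow> Z" "inj_on z' {..<m}"
      "linked G m (\<lambda>i. line_pt (y i) (w i)) (\<lambda>i. line_pt (z' i) (w i))" by blast
    then show ?thesis
      using linked_trans[OF zy z'(3)] z by (auto simp: mem_times_line)
  qed
qed

text \<open>The target may also have coinciding base points, so both tuples are separated, and the
  motion that separates the target is then reversed.\<close>

lemma times_line_transitive: "m_transitive (times_line Z) G m"
  unfolding m_transitive_linked
proof (intro allI impI, elim conjE)
  fix x y :: "nat \<Rightarrow> complex ^ 'n option"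
  assume xy: "x \<in> {..<m} \<rightarrow> times_line Z" "y \<in> {..<m} \<rightarrow> times_line Z"
    "inj_on x {..<m}" "inj_on y {..<m}"
  have sep: "\<exists>z'. z' \<in> {..<m} \<rightarrow> Z \<and> inj_on z' {..<m} \<and>
      linked G m u (\<lambda>i. line_pt (z' i) (u i $ None))"
    if "u \<in> {..<m} \<rightarrow> times_line Z" "inj_on u {..<m}" for u
    using separate_bases[of "\<lambda>i. base (u i)" m "\<lambda>i. u i $ None"] that
    by (auto simp: mem_times_line Pi_iff)
  obtain z1 where z1: "z1 \<in> {..<m} \<rightarrow> Z" "inj_on z1 {..<m}"
    "linked G m x (\<lambda>i. line_pt (z1 i) (x i $ None))"
    using sep[OF xy(1,3)] by blast
  obtain z2 where z2: "z2 \<in> {..<m} \<rightarrow> Z" "inj_on z2 {..<m}"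
    "linked G m y (\<lambda>i. line_pt (z2 i) (y i $ None))"
    using sep[OF xy(2,4)] by blast
  note [trans] = linked_trans
  note z1(3)
  also have "linked G m (\<lambda>i. line_pt (z1 i) (x i $ None)) (\<lambda>i. line_pt (z2 i) (x i $ None))"
    by (rule move_base[OF z1(1) z2(1) z1(2) z2(2)])
  also have "linked G m (\<lambda>i. line_pt (z2 i) (x i $ None)) (\<lambda>i. line_pt (z2 i) (y i $ None))"
    by (rule move_fibres[OF z2(1,2)])
  also have "linked G m (\<lambda>i. line_pt (z2 i) (y i $ None)) y"
    using linked_sym[OF z2(3)] xy(2) by auto
  finally show "linked G m x y" using xy(1) by auto
qed

end

text \<open>A single point is excluded because it is infinitely transitive for trivial reasons,
  while its product is an affine line, where the flows are translations and preserve differences of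
  points.\<close>

theorem proposition6p1:
  fixes Z :: "(complex ^ 'n::finite) set"
  assumes "complex_affine_manifold Z"
    and "\<forall>p. Z \<noteq> {p}"
    and "admits_infinitely_transitive_LNDs Z"
  shows "admits_infinitely_transitive_LNDs (times_line Z)"
proof (cases "Z = {}")
  \<comment> \<open>The empty variety is allowed; there only \<open>m = 0\<close> has any content,
    and the identity settles it.\<close>
  case True
  then have "times_line Z = {}" by (simp add: times_line_def)
  moreover have "m_transitive {} (flow_group {} {}) m" for m
    using flow_group_id by (fastforce simp: m_transitive_def)
  ultimately show ?thesis
    unfolding admits_infinitely_transitive_LNDs_def by (intro exI[of _ "{}"]) auto
next
  case False
  then obtain a b where ab: "a \<in> Z" "b \<in> Z" "a \<noteq> b" using assms(2) by blast
  then obtain l where l: "a $ l \<noteq> b $ l" by (auto simp: vec_eq_iff)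
  obtain S where S: "finite S" "\<And>D. D \<in> S \<Longrightarrow> locally_nilpotent_derivation Z D"
    "\<And>m. m_transitive Z (flow_group Z S) m"
    using assms(3) unfolding admits_infinitely_transitive_LNDs_def by blast
  interpret lifted_flows Z S l a b
    using S ab l by unfold_locales auto
  have "finite lifts" using S(1) by (simp add: lifts_def)
  then show ?thesis
    unfolding admits_infinitely_transitive_LNDs_def
    using lifts_lnd times_line_transitive by blast
qed

end
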